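(* Let $\ell(z)=e^z/(1+e^z)$, and let $g_1(\tau)=\ell\big(2\sin(\tau/2)\big)$, $\tau\in\mathbb R$, be the expenditure share of the first good of the two-good, one-agent homothetic market described in the context. Fix an integer $0\le q<\infty$, a constant $0\le G<\infty$ and $1\le T\le\infty$. Then $$\inf\ \sup_{\tau\in\mathbb R}\left|g_1(\tau)-\sum_{t=1}^Tw_t(\tau)\gamma_{t1}(\tau)\right|=\frac{\ell(2)-\ell(-2)}{2}=\frac{\tanh(1)}{2}\approx0.3808,$$ where the infimum is over all families $(w_t,\gamma_{t1})_{t=1}^T$ with $w_t\in\mathscr B^q$, $\sum_{t=1}^Tw_t\equiv1$, and $\gamma_{t1}:\mathbb R\to[0,1]$ with $\mathrm{TV}(\gamma_{t1})\le G$. The bound is attained with every android using a Cobb–Douglas (i.e. constant in $\tau$) share.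
   Context: With two goods and prices $\mathbf p=(p_1,p_2)$ in the interior of $\Delta_2$ (so $p_1+p_2=1$), everything is written as a function of the log-price ratio $\tau=\log(p_1/p_2)\in\mathbb R$; thus $p_1=\ell(\tau)$. Expenditure shares $(\gamma_1,\gamma_2)$ satisfy $\gamma_1+\gamma_2=1$, so only the first coordinate is considered. $\mathscr B^q$: the set of functions $w(\tau)=\sum_{k=0}^qc_k\,B^q_k(p_1(\tau))$ with $c_k\ge0$, where $B^q_k(s)=\binom qk s^k(1-s)^{q-k}$ are the Bernstein polynomials of degree $q$. $\mathrm{TV}(f)$ for $f:\mathbb R\to\mathbb R$ is the total variation, i.e. the supremum of $\sum_{j=1}^m|f(\tau_j)-f(\tau_{j-1})|$ over all finite $\tau_0<\dots<\tau_m$. The market generating $g_1$: put $r_x(\tau)=\exp(-\tau+2\sin(\tau/2))$, a strictly decreasing bijection $\mathbb R\to(0,\infty)$, and let the single agent have utility $u(x_1,x_2)=x_2\,\phi(x_1/x_2)$ with $\log\phi(\rho)=\int_1^\rho\frac{ds}{s+\exp(-r_x^{-1}(s))}$. This $u$ is homogeneous of degree one, increasing and concave, and the agent's expenditure share $g_1=p_1x_1/w$ satisfies $\log\frac{g_1}{1-g_1}=2\sin(\tau/2)$. *)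

theory Defs
  imports "HOL-Analysis.Analysis" "HOL-Library.Extended_Nat"
begin

definition ell :: "real \<Rightarrow> real" where
  "ell z = exp z / (1 + exp z)"

definition g1 :: "real \<Rightarrow> real" where
  "g1 \<tau> = ell (2 * sin (\<tau> / 2))"

subsection \<open>The market generating the share \<open>g1\<close>\<close>

text \<open>\<open>rx\<close> is a bijection from the reals onto the positive reals, so \<open>inv rx\<close> is meaningful
  at positive arguments only. The integral is oriented, hence negative for \<open>\<rho> < 1\<close>.\<close>

definition rx :: "real \<Rightarrow> real" where
  "rx \<tau> = exp (- \<tau> + 2 * sin (\<tau> / 2))"

definition phi :: "real \<Rightarrow> real" where
  "phi \<rho> = exp (LBINT s=ereal 1..ereal \<rho>. 1 / (s + exp (- inv rx s)))"

text \<open>The formula \<open>x\<^sub>2 \<phi>(x\<^sub>1/x\<^sub>2)\<close> makes sense for positive quantities; on the boundary of the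
  consumption set its continuous extension is \<open>0\<close>.\<close>

definition utility :: "real \<times> real \<Rightarrow> real" where
  "utility x = (if 0 < fst x \<and> 0 < snd x then snd x * phi (fst x / snd x) else 0)"

definition budget_set :: "real \<Rightarrow> real \<Rightarrow> real \<Rightarrow> (real \<times> real) set" where
  "budget_set p1 p2 b = {x. 0 \<le> fst x \<and> 0 \<le> snd x \<and> p1 * fst x + p2 * snd x \<le> b}"

definition demand :: "(real \<times> real \<Rightarrow> real) \<Rightarrow> real \<Rightarrow> real \<Rightarrow> real \<Rightarrow> (real \<times> real) set" where
  "demand u p1 p2 b =
     {x \<in> budget_set p1 p2 b. \<forall>y \<in> budget_set p1 p2 b. u y \<le> u x}"

subsection \<open>Markets of androids\<close>

definition bernstein_cone :: "nat \<Rightarrow> (real \<Rightarrow> real) set" where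
  "bernstein_cone q =
     {w. \<exists>c :: nat \<Rightarrow> real. (\<forall>k\<le>q. 0 \<le> c k) \<and>
           (\<forall>\<tau>. w \<tau> = (\<Sum>k\<le>q. c k * Bernstein q k (ell \<tau>)))}"

definition TV :: "(real \<Rightarrow> real) \<Rightarrow> ereal" where
  "TV f = (SUP (m, x) \<in> {(m :: nat, x :: nat \<Rightarrow> real). \<forall>j<m. x j < x (Suc j)}.
             ereal (\<Sum>j=1..m. \<bar>f (x j) - f (x (j - 1))\<bar>))"

text \<open>Androids are numbered \<open>1, \<dots>, T\<close>; for \<open>T = \<infinity>\<close> the index set is all of the positive naturals.\<close>

definition androids :: "enat \<Rightarrow> nat set" where
  "androids T = {t. 1 \<le> t \<and> enat t \<le> T}"

definition feasible ::
    "nat \<Rightarrow> real \<Rightarrow> enat \<Rightarrow> ((nat \<Rightarrow> real \<Rightarrow> real) \<times> (nat \<Rightarrow> real \<Rightarrow> real)) set" where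
  "feasible q G T =
     {(w, \<gamma>). (\<forall>t\<in>androids T. w t \<in> bernstein_cone q) \<and>
              (\<forall>\<tau>. ((\<lambda>t. w t \<tau>) has_sum 1) (androids T)) \<and>
              (\<forall>t\<in>androids T. (\<forall>\<tau>. \<gamma> t \<tau> \<in> {0..1}) \<and> TV (\<gamma> t) \<le> ereal G)}"

text \<open>On \<open>feasible\<close> families the terms below are nonnegative and dominated by the summable
  weights, so \<open>infsum\<close> never takes its default value.\<close>

definition sup_error ::
    "enat \<Rightarrow> (nat \<Rightarrow> real \<Rightarrow> real) \<times> (nat \<Rightarrow> real \<Rightarrow> real) \<Rightarrow> ereal" where
  "sup_error T = (\<lambda>(w, \<gamma>).
     SUP \<tau>. ereal \<bar>g1 \<tau> - (\<Sum>\<^sub>\<infinity>t\<in>androids T. w t \<tau> * \<gamma> t \<tau>)\<bar>)"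

end

theory Submission
  imports Defs
begin

text \<open>The first-order condition \<open>exp (- inv rx \<rho>) = p\<^sub>2 / p\<^sub>1\<close> for the optimal ratio \<open>\<rho> = x\<^sub>1 / x\<^sub>2\<close> gives
  \<open>\<rho> = rx (ln (p\<^sub>1 / p\<^sub>2))\<close>, so the odds of the share are \<open>p\<^sub>1 \<rho> / p\<^sub>2 = exp (2 sin (\<tau> / 2))\<close>.

  For the approximation error, evaluate along \<open>\<tau> = \<pi> + 2 \<pi> n\<close>, where \<open>g1\<close> alternates between \<open>ell 2\<close>
  and \<open>ell (- 2)\<close>. Bernstein weights converge as \<open>\<tau> \<rightarrow> \<infinity>\<close>, and the increments of a share of finite
  variation tend to zero along this sequence; by dominated convergence so do the increments of the
  aggregate, whose supremum distance to \<open>g1\<close> is therefore at least half the oscillation. The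
  constant share \<open>1/2\<close>, the midpoint of \<open>ell 2\<close> and \<open>ell (- 2)\<close>, attains this.\<close>

section \<open>The bijection \<open>rx\<close> and its inverse\<close>

lemma rx_pos [simp]: "0 < rx \<tau>"
  by (simp add: rx_def)

text \<open>The derivative of the exponent, \<open>cos (\<tau> / 2) - 1\<close>, vanishes at
  multiples of \<open>4 * pi\<close>, so its sign alone does not give strictness. The sum-to-product
  formula reduces the claim to \<open>\<bar>sin d\<bar> < d\<close> for
  \<open>d = (y - x) / 4\<close>.\<close>

lemma rx_strict_antimono:
  assumes "x < y" shows "rx y < rx x"
proof -
  define d where "d = (y - x) / 4"
  have d: "0 < d" using assms by (simp add: d_def)
  have "(y / 2 - x / 2) / 2 = d" "(y / 2 + x / 2) / 2 = (y + x) / 4"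
    by (simp_all add: d_def field_simps)
  then have "sin (y / 2) - sin (x / 2) = 2 * (sin d * cos ((y + x) / 4))"
    using sin_diff_sin[of "y / 2" "x / 2"] by (simp only: mult.assoc)
  also have "\<dots> \<le> 2 * \<bar>sin d\<bar>"
  proof -
    have "sin d * cos ((y + x) / 4) \<le> \<bar>sin d\<bar> * \<bar>cos ((y + x) / 4)\<bar>"
      by (metis abs_ge_self abs_mult)
    also have "\<dots> \<le> \<bar>sin d\<bar> * 1" by (rule mult_left_mono) auto
    finally show ?thesis by simp
  qed
  also have "\<dots> < 2 * d"
  proof (cases "d \<le> 1")
    case True
    then have "0 < sin d" using d pi_gt3 by (intro sin_gt_zero) auto
    moreover have "sin d < d"
    proof -
      have "(\<lambda>x. x - sin x) 0 < (\<lambda>x. x - sin x) d"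
      proof (rule DERIV_pos_imp_increasing_open[OF d])
        fix t assume t: "0 < t" "t < d"
        have "cos t < cos 0" using t True pi_gt3 by (intro cos_monotone_0_pi) auto
        then show "\<exists>y. ((\<lambda>x. x - sin x) has_real_derivative y) (at t) \<and> 0 < y"
          by (intro exI[of _ "1 - cos t"]) (auto intro!: derivative_eq_intros)
      qed (intro continuous_intros)
      then show ?thesis by simp
    qed
    ultimately show ?thesis by simp
  next
    case False
    then show ?thesis using abs_sin_le_one[of d] by linarith
  qed
  finally show ?thesis by (simp add: rx_def d_def)
qed

lemma inj_rx: "inj rx"
  by (rule injI) (metis rx_strict_antimono less_irrefl linorder_neqE)

lemma range_rx: "range rx = {0<..}"
proof
  show "{0<..} \<subseteq> range rx"
  proof
    fix s :: real assume "s \<in> {0<..}"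
    then have s: "0 < s" by simp
    define f where "f = (\<lambda>\<tau>::real. - \<tau> + 2 * sin (\<tau> / 2))"
    \<comment> \<open>The sine term is at most 2 in absolute value, so
      \<open>f K \<le> - \<bar>ln s\<bar>\<close> and
      \<open>\<bar>ln s\<bar> \<le> f (- K)\<close>.\<close>
    define K where "K = \<bar>ln s\<bar> + 2"
    have "f K \<le> ln s"
      using sin_le_one[of "K / 2"] abs_ge_self[of "ln s"] abs_ge_minus_self[of "ln s"]
      unfolding f_def K_def by linarith
    moreover have "ln s \<le> f (- K)"
      using sin_ge_minus_one[of "- K / 2"] abs_ge_self[of "ln s"] unfolding f_def K_def by linarith
    moreover have "- K \<le> K" by (simp add: K_def)
    moreover have "continuous_on {- K..K} f" unfolding f_def by (intro continuous_intros)  auto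
    ultimately obtain \<tau> where "f \<tau> = ln s" using IVT2'[of f K "ln s" "- K"] by blast
    then have "rx \<tau> = s" using s by (simp add: rx_def f_def)
    then show "s \<in> range rx" by blast
  qed
qed auto

lemma inv_rx_rx [simp]: "inv rx (rx \<tau>) = \<tau>"
  by (simp add: inj_rx)

lemma inv_rx_strict_antimono:
  assumes "0 < s" "s < t" shows "inv rx t < inv rx s"
proof -
  have "s \<in> range rx" "t \<in> range rx" using assms by (auto simp: range_rx)
  then obtain \<sigma> \<tau> where "s = rx \<sigma>" "t = rx \<tau>" by blast
  then show ?thesis using assms rx_strict_antimono[of \<sigma> \<tau>] by (cases \<sigma> \<tau> rule: linorder_cases) auto
qed

text \<open>A monotone function with open image is continuous. Here the image is the whole positive
  half-line, since \<open>rx (- ln y)\<close> is mapped to \<open>y\<close>.\<close>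

lemma continuous_on_exp_minus_inv_rx: "continuous_on {0<..} (\<lambda>s. exp (- inv rx s))"
proof (rule continuous_onI_mono)
  have "y \<in> (\<lambda>s. exp (- inv rx s)) ` {0<..}" if "0 < y" for y :: real
    using that by (intro image_eqI[of _ _ "rx (- ln y)"]) auto
  then have "(\<lambda>s. exp (- inv rx s)) ` {0<..} = {0<..}" by auto
  then show "open ((\<lambda>s. exp (- inv rx s)) ` {0<..})" by simp
  show "exp (- inv rx x) \<le> exp (- inv rx y)" if "x \<in> {0<..}" "y \<in> {0<..}" "x \<le> y" for x y
    using that inv_rx_strict_antimono[of x y] by (cases "x = y") auto
qed

section \<open>Derivative of \<open>ln phi\<close> and the optimal ratio\<close>

lemma phi_pos [simp]: "0 < phi \<rho>"
  by (simp add: phi_def)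

lemma ln_phi_has_derivative:
  assumes "0 < \<rho>"
  shows "((\<lambda>\<rho>. ln (phi \<rho>)) has_real_derivative 1 / (\<rho> + exp (- inv rx \<rho>))) (at \<rho>)"
proof -
  \<comment> \<open>The interval from \<open>a\<close> to \<open>b\<close> contains the base point 1
    of the integral, has \<open>\<rho>\<close> in its interior and stays within the positive reals,
    where the integrand is continuous.\<close>
  define a where "a = min 1 \<rho> / 2"
  define b where "b = max 1 \<rho> + 1"
  have ab: "0 < a" "a \<le> 1" "1 \<le> b" "a < \<rho>" "\<rho> < b" using assms by (auto simp: a_def b_def)
  let ?f = "\<lambda>s. 1 / (s + exp (- inv rx s))"
  have "continuous_on {a..b} (\<lambda>s. exp (- inv rx s))"
    by (rule continuous_on_subset[OF continuous_on_exp_minus_inv_rx]) (use ab in auto)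
  moreover have "s + exp (- inv rx s) \<noteq> 0" if "s \<in> {a..b}" for s
    using that ab add_pos_pos[of s "exp (- inv rx s)"] by simp
  ultimately have "continuous_on {a..b} ?f"
    by (intro continuous_on_divide continuous_on_add continuous_on_const continuous_on_id) auto
  then have "((\<lambda>u. LBINT y=ereal 1..ereal u. ?f y) has_vector_derivative ?f \<rho>) (at \<rho> within {a..b})"
    using ab by (intro interval_integral_FTC2) auto
  moreover have "at \<rho> within {a..b} = at \<rho>"
    using ab by (intro at_within_interior) auto
  ultimately show ?thesis
    by (simp add: phi_def has_real_derivative_iff_has_vector_derivative)
qed

text \<open>The derivative of the logarithm of the left-hand side has the sign of
  \<open>\<kappa> - exp (- inv rx \<rho>)\<close>, which is decreasing in \<open>\<rho>\<close> and vanishes at \<open>\<rho> = rx (- ln \<kappa>)\<close>.\<close>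

lemma phi_over_affine_less:
  assumes "0 < \<rho>" "0 < \<kappa>" and ne: "\<rho> \<noteq> rx (- ln \<kappa>)"
  shows "phi \<rho> / (\<rho> + \<kappa>) < phi (rx (- ln \<kappa>)) / (rx (- ln \<kappa>) + \<kappa>)"
proof -
  define r where "r = rx (- ln \<kappa>)"
  define \<psi> where "\<psi> = (\<lambda>\<rho>. ln (phi \<rho>) - ln (\<rho> + \<kappa>))"
  have r: "0 < r" and hr: "exp (- inv rx r) = \<kappa>" using assms by (auto simp: r_def)
  have D: "(\<psi> has_real_derivative 1 / (x + exp (- inv rx x)) - 1 / (x + \<kappa>)) (at x)" if "0 < x" for x
  proof -
    have "((\<lambda>\<rho>. ln (\<rho> + \<kappa>)) has_real_derivative 1 / (x + \<kappa>)) (at x)"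
      using that assms by (auto intro!: derivative_eq_intros)
    then show ?thesis
      unfolding \<psi>_def by (rule DERIV_diff[OF ln_phi_has_derivative[OF that]])
  qed
  have cont: "continuous_on {x..y} \<psi>" if "0 < x" for x y
    using that D by (intro continuous_at_imp_continuous_on ballI DERIV_isCont[OF D]) auto
  have "\<psi> \<rho> < \<psi> r"
  proof (cases "\<rho> < r")
    case True
    then show ?thesis
    proof (rule DERIV_pos_imp_increasing_open)
      fix x assume x: "\<rho> < x" "x < r"
      then have "exp (- inv rx x) < \<kappa>"
        using inv_rx_strict_antimono[of x r] assms hr by auto
      then have "1 / (x + \<kappa>) < 1 / (x + exp (- inv rx x))"
        using x assms by (intro divide_strict_left_mono mult_pos_pos add_pos_pos) auto
      then show "\<exists>y. (\<psi> has_real_derivative y) (at x) \<and> 0 < y"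
        using D[of x] x assms by auto
    qed (use cont assms in auto)
  next
    case False
    then have "r < \<rho>" using ne r_def by simp
    then show ?thesis
    proof (rule DERIV_neg_imp_decreasing_open)
      fix x assume x: "r < x" "x < \<rho>"
      then have "\<kappa> < exp (- inv rx x)"
        using inv_rx_strict_antimono[of r x] r hr by auto
      then have "1 / (x + \<kappa>) > 1 / (x + exp (- inv rx x))"
        using x r assms by (intro divide_strict_left_mono mult_pos_pos add_pos_pos) auto
      then show "\<exists>y. (\<psi> has_real_derivative y) (at x) \<and> y < 0"
        using D[of x] x r by auto
    qed (use cont r in auto)
  qed
  then have "ln (phi \<rho> / (\<rho> + \<kappa>)) < ln (phi r / (r + \<kappa>))"
    using assms r by (simp add: \<psi>_def ln_div less_imp_neq[OF phi_pos, symmetric])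
  then show ?thesis
    using assms r unfolding r_def[symmetric] by (subst (asm) ln_less_cancel_iff) (auto intro: add_pos_pos)
qed

section \<open>Demand and expenditure share\<close>

text \<open>Homogeneity reduces the problem to the ratio \<open>r\<close> of the two quantities:
  spending all of \<open>b\<close> at ratio \<open>r\<close> yields
  \<open>b * phi r / (p1 * r + p2)\<close>, which has a strict maximum at \<open>\<rho>\<close>.
  Bundles with a zero coordinate have utility 0, less than \<open>V\<close>.\<close>

lemma demand_utility:
  assumes p: "0 < p1" "0 < p2" and b: "0 < b"
  defines "\<rho> \<equiv> rx (ln (p1 / p2))"
  shows "demand utility p1 p2 b = {(\<rho> * (b / (p1 * \<rho> + p2)), b / (p1 * \<rho> + p2))}"
    (is "_ = {?x}")
proof -
  have \<rho>: "0 < \<rho>" by (simp add: \<rho>_def)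
  have D: "0 < p1 * \<rho> + p2" using p \<rho> by (intro add_pos_pos) auto
  have \<rho>_eq: "\<rho> = rx (- ln (p2 / p1))" using p by (simp add: \<rho>_def ln_div)
  \<comment> \<open>The maximal utility, written as a multiple of
    \<open>phi \<rho> / (\<rho> + \<kappa>)\<close> with \<open>\<kappa> = p2 / p1\<close>.\<close>
  define V where "V = b / p1 * (phi \<rho> / (\<rho> + p2 / p1))"
  have V: "0 < V" using p b \<rho> by (auto simp: V_def intro!: divide_pos_pos mult_pos_pos add_pos_pos)
  have scale: "b / p1 * (phi r / (r + p2 / p1)) = b * phi r / (p1 * r + p2)" for r
    using p by (simp add: field_simps)
  have ux: "utility ?x = V"
    unfolding V_def scale using \<rho> D b by (simp add: utility_def)
  have x: "?x \<in> budget_set p1 p2 b"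
  proof -
    have "p1 * (\<rho> * c) + p2 * c = (p1 * \<rho> + p2) * c" for c
      by (simp add: distrib_right mult.assoc)
    then have "p1 * (\<rho> * (b / (p1 * \<rho> + p2))) + p2 * (b / (p1 * \<rho> + p2)) = b"
      using D by (simp only:) simp
    then show ?thesis using \<rho> D b by (simp add: budget_set_def)
  qed
  have less: "utility y < V" if y: "y \<in> budget_set p1 p2 b" "y \<noteq> ?x" for y
  proof (cases "0 < fst y \<and> 0 < snd y")
    case True
    define r where "r = fst y / snd y"
    have r: "0 < r" and y1: "fst y = r * snd y" using True by (auto simp: r_def)
    have Dr: "0 < p1 * r + p2" using p r by (intro add_pos_pos) auto
    have "snd y * (p1 * r + p2) \<le> b" using y(1) y1 by (simp add: budget_set_def algebra_simps)
    then have le: "snd y \<le> b / (p1 * r + p2)" using Dr by (simp add: field_simps)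
    have u: "utility y = snd y * phi r" using True by (simp add: utility_def r_def)
    \<comment> \<open>At the optimal ratio, a bundle other than the candidate leaves part of the
      budget unspent; at any other ratio, strictness comes from the strict maximum.\<close>
    show ?thesis
    proof (cases "r = \<rho>")
      case True
      then have "snd y \<noteq> b / (p1 * r + p2)" using y(2) y1 by (metis prod.collapse)
      then have "snd y * phi r < b / (p1 * r + p2) * phi r"
        using le by (intro mult_strict_right_mono) auto
      then show ?thesis unfolding u V_def scale using True by simp
    next
      case False
      have "snd y * phi r \<le> b / (p1 * r + p2) * phi r"
        using le by (intro mult_right_mono) (auto intro: less_imp_le)
      also have "\<dots> = b / p1 * (phi r / (r + p2 / p1))" unfolding scale by simp
      also have "\<dots> < V"
        using phi_over_affine_less[of r "p2 / p1"] False r p b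
        unfolding V_def \<rho>_eq by (intro mult_strict_left_mono) auto
      finally show ?thesis using u by simp
    qed
  qed (use V in \<open>auto simp: utility_def\<close>)
  show ?thesis
  proof (intro equalityI subsetI)
    fix y assume "y \<in> demand utility p1 p2 b"
    then have "y \<in> budget_set p1 p2 b" "V \<le> utility y"
      using x unfolding demand_def ux[symmetric] by blast+
    then have "y = ?x" using less leD by blast
    then show "y \<in> {?x}" by simp
  next
    fix y assume "y \<in> {?x}"
    then have y: "y = ?x" by simp
    have "utility z \<le> utility ?x" if "z \<in> budget_set p1 p2 b" for z
    proof (cases "z = ?x")
      case True
      then show ?thesis by (simp only: order_refl)
    next
      case False
      show ?thesis unfolding ux using less[OF that False] by (rule less_imp_le)
    qed
    then show "y \<in> demand utility p1 p2 b"
      unfolding y demand_def using x by (intro CollectI conjI ballI)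
  qed
qed

lemma expenditure_share_utility:
  assumes "0 < p1" "0 < p2" "0 < b" "x \<in> demand utility p1 p2 b"
  shows "p1 * fst x / b = g1 (ln (p1 / p2))"
proof -
  define \<tau> where "\<tau> = ln (p1 / p2)"
  have e: "p1 = p2 * exp \<tau>" using assms by (simp add: \<tau>_def)
  define E where "E = exp (2 * sin (\<tau> / 2))"
  have "p1 * rx \<tau> = p2 * E"
    unfolding e rx_def exp_add exp_minus E_def by simp
  moreover have "fst x = rx \<tau> * (b / (p1 * rx \<tau> + p2))"
    using assms by (simp add: demand_utility \<tau>_def)
  ultimately have "p1 * fst x / b = p2 * E / (p2 * E + p2)"
    using assms by simp
  also have "\<dots> = p2 * E / (p2 * (1 + E))" by (simp add: algebra_simps)
  also have "\<dots> = g1 \<tau>" using assms by (simp add: g1_def ell_def E_def)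
  finally show ?thesis by (simp add: \<tau>_def)
qed

section \<open>The logistic function and the value of the constant\<close>

lemma one_plus_exp_neq_0 [simp]: "1 + exp (z::real) \<noteq> 0"
  by (metis add_pos_pos exp_gt_zero less_irrefl zero_less_one)

lemma ell_bounds: "0 < ell z" "ell z < 1"
  by (simp_all add: ell_def add_pos_pos)

lemma ell_minus: "ell (- z) = 1 - ell z"
  by (simp add: ell_def exp_minus field_simps)

lemma ell_mono: assumes "x \<le> y" shows "ell x \<le> ell y"
proof -
  have e: "ell z = 1 - 1 / (1 + exp z)" for z by (simp add: ell_def field_simps)
  have "1 / (1 + exp y) \<le> 1 / (1 + exp x)"
    using assms by (intro divide_left_mono) (auto simp: add_pos_pos)
  then show ?thesis by (simp add: e)
qed

lemma ell_at_top: "(ell \<longlongrightarrow> 1) at_top"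
proof -
  have e: "ell = (\<lambda>z. 1 - 1 / (1 + exp z))" by (auto simp: ell_def field_simps)
  have "((\<lambda>z::real. 1 - 1 / (1 + exp z)) \<longlongrightarrow> 1 - 0) at_top"
    by (intro tendsto_intros tendsto_divide_0[OF tendsto_const] filterlim_at_top_imp_at_infinity
        filterlim_tendsto_add_at_top[OF tendsto_const] exp_at_top)
  then show ?thesis by (simp add: e)
qed

text \<open>Both sides equal \<open>ell 2 - 1 / 2\<close>: the left one by the symmetry of
  \<open>ell\<close>, the right one because \<open>tanh 1 = 2 * ell 2 - 1\<close>.\<close>

lemma ell_diff_eq_tanh: "(ell 2 - ell (- 2)) / 2 = tanh 1 / 2"
proof -
  define E :: real where "E = exp 2"
  have E: "0 < E" by (simp add: E_def)
  have "tanh (1::real) = (1 - 1 / E) / (1 + 1 / E)"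
    by (simp add: tanh_real_altdef E_def exp_minus inverse_eq_divide)
  also have "1 - 1 / E = (E - 1) / E" using E by (simp add: field_simps)
  also have "1 + 1 / E = (E + 1) / E" using E by (simp add: field_simps)
  also have "(E - 1) / E / ((E + 1) / E) = (E - 1) / (1 + E)" using E by simp
  also have "\<dots> = 2 * (E / (1 + E)) - 1" using E by (simp add: field_simps)
  also have "E / (1 + E) = ell 2" by (simp add: ell_def E_def)
  finally show ?thesis by (simp add: ell_minus)
qed

text \<open>The Taylor polynomial of degree 8 with Lagrange remainder gives \<open>exp (- 1)\<close>
  to within \<open>3 / fact 9\<close>. Its square enters
  \<open>tanh 1 = (1 - exp (- 2)) / (1 + exp (- 2))\<close>.\<close>

lemma tanh_1_approx: "\<bar>tanh 1 / 2 - 0.3808 :: real\<bar> < 0.00005"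
proof -
  have sum9: "(\<Sum>m<9. x ^ m / fact m) =
      1 + x + x^2/2 + x^3/6 + x^4/24 + x^5/120 + x^6/720 + x^7/5040 + x^8/40320" for x :: real
    by (simp add: eval_nat_numeral fact_numeral)
  obtain t :: real where t: "\<bar>t\<bar> \<le> \<bar>- 1\<bar>"
    "exp (- 1) = (\<Sum>m<9. ((- 1) ^ m) / fact m) + (exp t / fact 9) * (- 1) ^ 9"
    using Maclaurin_exp_le[of "- 1" 9] by blast
  define R where "R = exp t"
  have R: "0 < R" "R \<le> 3"
    using t(1) exp_le order_trans[of "exp t" "exp 1" 3] by (simp_all add: R_def)
  have "exp (- 1) = 14833 / 40320 - R / 362880"
    unfolding t(2) sum9 R_def by (simp add: fact_numeral)
  with R have e: "0.36786 < exp (- 1::real)" "exp (- 1::real) < 0.36789"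
    by simp_all
  define E :: real where "E = exp (- 1)"
  have "0.36786 ^ 2 < E ^ 2" "E ^ 2 < 0.36789 ^ 2"
    using e unfolding E_def by (intro power_strict_mono; simp)+
  moreover have "exp (- 2::real) = E ^ 2" by (simp add: E_def flip: exp_of_nat_mult)
  ultimately have "0.36786 ^ 2 < exp (- 2::real)" "exp (- 2::real) < 0.36789 ^ 2" by auto
  \<comment> \<open>Halving these bounds gives exactly the required tolerance, 0.38075 to
    0.38085.\<close>
  then have "0.7615 < tanh (1::real)" "tanh (1::real) < 0.7617"
    by (simp_all add: tanh_real_altdef field_simps power2_eq_square)
  then show ?thesis unfolding abs_less_iff by (intro conjI) simp_all
qed

section \<open>Range and oscillation of \<open>g1\<close>\<close>

lemma abs_g1_diff_half_le: "\<bar>g1 \<tau> - 1 / 2\<bar> \<le> (ell 2 - ell (- 2)) / 2"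
proof -
  have "ell (- 2) \<le> g1 \<tau>" "g1 \<tau> \<le> ell 2"
    using sin_ge_minus_one[of "\<tau> / 2"] sin_le_one[of "\<tau> / 2"] unfolding g1_def
    by (intro ell_mono; linarith)+
  then show ?thesis using ell_minus[of 2] by (simp add: abs_le_iff field_simps)
qed

lemma g1_consecutive_peaks:
  "\<bar>g1 (pi + 2 * pi * real (Suc n)) - g1 (pi + 2 * pi * real n)\<bar> = ell 2 - ell (- 2)"
proof -
  have sin: "sin ((pi + 2 * pi * real n) / 2) = (- 1) ^ n" for n
  proof -
    have "(pi + 2 * pi * real n) / 2 = pi / 2 + pi * real n" by (simp add: field_simps)
    then show ?thesis by (simp only: sin_add) simp
  qed
  have "g1 (pi + 2 * pi * real m) = (if even m then ell 2 else ell (- 2))" for m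
    unfolding g1_def sin by simp
  moreover have "ell (- 2) \<le> ell 2" by (rule ell_mono) simp
  ultimately show ?thesis by (auto simp del: of_nat_Suc)
qed

section \<open>Finite variation, Bernstein weights and dominated convergence\<close>

text \<open>The absolute increments along \<open>x\<close> have partial sums bounded by
  \<open>G\<close>, so they form a convergent series and its terms vanish in the limit.\<close>

lemma TV_finite_increments_tendsto_0:
  assumes "strict_mono x" and TV: "TV f \<le> ereal G"
  shows "(\<lambda>n. f (x (Suc n)) - f (x n)) \<longlonglongrightarrow> 0"
proof -
  have "(\<Sum>j<m. \<bar>f (x (Suc j)) - f (x j)\<bar>) \<le> G" for m
  proof -
    have "(m, x) \<in> {(m, x). \<forall>j<m. x j < x (Suc j)}"
      using assms(1) by (simp add: strict_mono_Suc_iff)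
    then have "ereal (\<Sum>j=1..m. \<bar>f (x j) - f (x (j - 1))\<bar>) \<le> TV f"
      unfolding TV_def by (rule SUP_upper2) simp
    then have "(\<Sum>j=1..m. \<bar>f (x j) - f (x (j - 1))\<bar>) \<le> G"
      using TV order_trans by fastforce
    then show ?thesis
      by (simp add: sum.atLeast1_atMost_eq lessThan_Suc_atMost)
  qed
  then have "summable (\<lambda>j. \<bar>f (x (Suc j)) - f (x j)\<bar>)"
    by (intro bounded_imp_summable[of _ G]) (simp_all only: abs_ge_zero flip: lessThan_Suc_atMost)
  then show ?thesis by (auto dest!: summable_LIMSEQ_zero simp: tendsto_rabs_zero_iff)
qed

lemma bernstein_cone_nonneg:
  assumes "w \<in> bernstein_cone q" shows "0 \<le> w \<tau>"
proof -
  have "0 \<le> Bernstein q k (ell \<tau>)" for k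
    using ell_bounds[of \<tau>] by (intro Bernstein_nonneg) auto
  then show ?thesis using assms by (auto simp: bernstein_cone_def intro!: sum_nonneg)
qed

text \<open>At \<open>\<tau> = 0\<close> the argument of the Bernstein polynomials is \<open>1/2\<close>, where all of them are at least
  \<open>2\<^sup>-\<^sup>q\<close>. So the weights of a family are dominated uniformly in \<open>\<tau>\<close> by a summable family.\<close>

lemma bernstein_cone_le:
  assumes "w \<in> bernstein_cone q" shows "w \<tau> \<le> 2 ^ q * w 0"
proof -
  obtain c where c: "\<forall>k\<le>q. 0 \<le> c k" and w: "\<And>\<tau>. w \<tau> = (\<Sum>k\<le>q. c k * Bernstein q k (ell \<tau>))"
    using assms by (auto simp: bernstein_cone_def)
  have half: "ell 0 = 1 / 2" by (simp add: ell_def)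
  have "w \<tau> \<le> (\<Sum>k\<le>q. c k * (2 ^ q * Bernstein q k (1 / 2)))"
    unfolding w
  proof (intro sum_mono mult_left_mono)
    fix k assume k: "k \<in> {..q}"
    \<comment> \<open>The bound passes through 1: a single Bernstein polynomial is at most the sum
      of all of them, and the binomial coefficient is at least 1.\<close>
    have "Bernstein q k (ell \<tau>) \<le> (\<Sum>k\<le>q. Bernstein q k (ell \<tau>))"
      using k ell_bounds[of \<tau>] by (intro member_le_sum Bernstein_nonneg) auto
    also have "\<dots> = 1" by simp
    also have "1 \<le> real (q choose k)" using k by (simp add: Suc_leI)
    also have "\<dots> = 2 ^ q * Bernstein q k (1 / 2)"
    proof -
      have "(1 / 2) ^ k * (1 / 2) ^ (q - k) = ((1 / 2) ^ q :: real)"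
        using k by (simp flip: power_add)
      then show ?thesis by (simp add: Bernstein_def power_one_over mult.assoc)
    qed
    finally show "Bernstein q k (ell \<tau>) \<le> 2 ^ q * Bernstein q k (1 / 2)" .
  qed (use c in auto)
  also have "\<dots> = 2 ^ q * w 0" by (simp add: w half sum_distrib_left mult_ac)
  finally show ?thesis .
qed

text \<open>A weight is a polynomial in \<open>ell \<tau>\<close>, hence extends continuously to the
  boundary price \<open>p1 = 1\<close>.\<close>

lemma bernstein_cone_convergent_at_top:
  assumes "w \<in> bernstein_cone q" obtains L where "(w \<longlongrightarrow> L) at_top"
proof -
  obtain c where w: "w = (\<lambda>\<tau>. \<Sum>k\<le>q. c k * Bernstein q k (ell \<tau>))"
    using assms by (auto simp: bernstein_cone_def)
  have "(w \<longlongrightarrow> (\<Sum>k\<le>q. c k * Bernstein q k 1)) at_top"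
    unfolding w Bernstein_def by (intro tendsto_intros ell_at_top)
  then show thesis by (rule that)
qed

text \<open>Dominated convergence for unordered sums, covering finitely and infinitely many androids
  at once. Extension by zero outside \<open>A\<close> turns the sums into series, to which Tannery's
  theorem applies.\<close>

lemma tendsto_infsum_dominated:
  fixes f :: "nat \<Rightarrow> 'b \<Rightarrow> real"
  assumes lim: "\<And>k. k \<in> A \<Longrightarrow> (f k \<longlongrightarrow> g k) F"
    and bound: "\<And>k n. k \<in> A \<Longrightarrow> \<bar>f k n\<bar> \<le> M k" and M: "M summable_on A" and F: "F \<noteq> bot"
  shows "((\<lambda>n. \<Sum>\<^sub>\<infinity>k\<in>A. f k n) \<longlongrightarrow> (\<Sum>\<^sub>\<infinity>k\<in>A. g k)) F"
proof -
  let ?z = "\<lambda>h k. if k \<in> A then h k else (0::real)"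
  have z: "?z h summable_on UNIV \<longleftrightarrow> h summable_on A" "infsum (?z h) UNIV = infsum h A" for h
    by (rule summable_on_cong_neutral infsum_cong_neutral; auto)+
  have suminf: "infsum h A = suminf (?z h)" if "h summable_on A" for h
  proof -
    have "?z h sums infsum (?z h) UNIV"
      using that z(1) by (intro has_sum_imp_sums has_sum_infsum) blast
    then show ?thesis unfolding z(2) by (rule sums_unique)
  qed
  have dom: "h summable_on A" if "\<And>k. k \<in> A \<Longrightarrow> \<bar>h k\<bar> \<le> M k" for h
    by (rule abs_summable_summable, rule Infinite_Sum.abs_summable_on_comparison_test'[OF M])
      (use that in auto)
  \<comment> \<open>The limit inherits the bound, so its unordered sum exists too and agrees with
    the series.\<close>
  have gM: "\<bar>g k\<bar> \<le> M k" if "k \<in> A" for k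
    using tendsto_upperbound[OF tendsto_rabs[OF lim[OF that]] always_eventually F] bound[OF that] by blast
  have "((\<lambda>n. \<Sum>k. ?z (\<lambda>k. f k n) k) \<longlongrightarrow> suminf (?z g)) F"
  proof (rule tannerys_theorem[THEN conjunct2, THEN conjunct2])
    show "summable (?z M)" using M z by (intro summable_on_imp_summable) auto
    show "\<forall>\<^sub>F (k, n) in at_top \<times>\<^sub>F F. norm (?z (\<lambda>k. f k n) k) \<le> ?z M k"
      using bound by (intro always_eventually) auto
  qed (use lim F in auto)
  then show ?thesis using suminf dom bound gM by simp
qed

section \<open>Lower bound for every family\<close>

lemma half_spread_le_sup_error:
  assumes "(w, \<gamma>) \<in> feasible q G T"
  shows "ereal ((ell 2 - ell (- 2)) / 2) \<le> sup_error T (w, \<gamma>)"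
proof (rule ccontr)
  define A where "A = androids T"
  define S where "S = (\<lambda>\<tau>. \<Sum>\<^sub>\<infinity>t\<in>A. w t \<tau> * \<gamma> t \<tau>)"
  define x where "x = (\<lambda>n. pi + 2 * pi * real n)"
  have w: "\<And>t. t \<in> A \<Longrightarrow> w t \<in> bernstein_cone q"
    and w1: "\<And>\<tau>. ((\<lambda>t. w t \<tau>) has_sum 1) A"
    and \<gamma>: "\<And>t \<tau>. t \<in> A \<Longrightarrow> 0 \<le> \<gamma> t \<tau> \<and> \<gamma> t \<tau> \<le> 1"
    and TV: "\<And>t. t \<in> A \<Longrightarrow> TV (\<gamma> t) \<le> ereal G"
    using assms by (auto simp: feasible_def A_def)
  have abs_w: "\<bar>w t \<tau> * \<gamma> t \<tau>\<bar> \<le> w t \<tau>" if "t \<in> A" for t \<tau>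
    using bernstein_cone_nonneg[OF w[OF that], of \<tau>] \<gamma>[OF that, of \<tau>]
    by (simp add: abs_mult mult_left_le)
  have smono: "strict_mono x" by (simp add: x_def strict_mono_Suc_iff)
  have x_top: "filterlim x at_top sequentially"
    unfolding x_def by (intro filterlim_tendsto_add_at_top[OF tendsto_const]
        filterlim_tendsto_pos_mult_at_top[OF tendsto_const] filterlim_real_sequentially) auto
  \<comment> \<open>Summability keeps \<open>infsum\<close> from its default value 0 and lets it
    split over differences.\<close>
  have summ: "(\<lambda>t. w t \<tau> * \<gamma> t \<tau>) summable_on A" for \<tau>
    by (rule abs_summable_summable, rule Infinite_Sum.abs_summable_on_comparison_test'[OF has_sum_imp_summable[OF w1]])
      (use abs_w in auto)
  have lim: "(\<lambda>n. w t (x (Suc n)) * \<gamma> t (x (Suc n)) - w t (x n) * \<gamma> t (x n)) \<longlonglongrightarrow> 0" if t: "t \<in> A" for t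
  proof -
    obtain L where "(w t \<longlongrightarrow> L) at_top" using bernstein_cone_convergent_at_top[OF w[OF t]] .
    then have wL: "(\<lambda>n. w t (x n)) \<longlonglongrightarrow> L" using x_top by (rule filterlim_compose)
    then have wL': "(\<lambda>n. w t (x (Suc n))) \<longlonglongrightarrow> L" by (rule LIMSEQ_Suc)
    \<comment> \<open>Discrete product rule: one part is a convergent weight times a vanishing share
      increment, the other a vanishing weight increment times a bounded share.\<close>
    have "(\<lambda>n. w t (x (Suc n)) * (\<gamma> t (x (Suc n)) - \<gamma> t (x n))) \<longlonglongrightarrow> L * 0"
      using wL' TV_finite_increments_tendsto_0[OF smono TV[OF t]] by (rule tendsto_mult)
    moreover have "(\<lambda>n. (w t (x (Suc n)) - w t (x n)) * \<gamma> t (x n)) \<longlonglongrightarrow> 0"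
    proof (rule Lim_null_comparison)
      show "(\<lambda>n. \<bar>w t (x (Suc n)) - w t (x n)\<bar>) \<longlonglongrightarrow> 0"
        using tendsto_rabs[OF tendsto_diff[OF wL' wL]] by simp
      show "\<forall>\<^sub>F n in sequentially. norm ((w t (x (Suc n)) - w t (x n)) * \<gamma> t (x n)) \<le>
          \<bar>w t (x (Suc n)) - w t (x n)\<bar>"
        using \<gamma>[OF t] by (intro always_eventually) (auto simp: abs_mult mult_left_le)
    qed
    ultimately have "(\<lambda>n. w t (x (Suc n)) * (\<gamma> t (x (Suc n)) - \<gamma> t (x n)) +
        (w t (x (Suc n)) - w t (x n)) * \<gamma> t (x n)) \<longlonglongrightarrow> L * 0 + 0"
      by (rule tendsto_add)
    then show ?thesis by (simp add: algebra_simps)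
  qed
  have "(\<lambda>n. \<Sum>\<^sub>\<infinity>t\<in>A. w t (x (Suc n)) * \<gamma> t (x (Suc n)) - w t (x n) * \<gamma> t (x n))
      \<longlonglongrightarrow> (\<Sum>\<^sub>\<infinity>t\<in>A. 0)"
  proof (rule tendsto_infsum_dominated[OF lim])
    \<comment> \<open>Each of the two products is at most its weight, hence at most
      \<open>2 ^ q * w t 0\<close>, uniformly in \<open>n\<close>. The weights at 0 sum to
      1.\<close>
    show "(\<lambda>t. 2 * (2 ^ q * w t 0)) summable_on A"
      using w1[of 0] by (intro summable_on_cmult_right) (auto simp: has_sum_iff)
    show "\<bar>w t (x (Suc n)) * \<gamma> t (x (Suc n)) - w t (x n) * \<gamma> t (x n)\<bar> \<le> 2 * (2 ^ q * w t 0)"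
      if t: "t \<in> A" for t n
      using abs_w[OF t, of "x n"] abs_w[OF t, of "x (Suc n)"]
        bernstein_cone_le[OF w[OF t], of "x n"] bernstein_cone_le[OF w[OF t], of "x (Suc n)"]
      by linarith
  qed auto
  moreover have "(\<Sum>\<^sub>\<infinity>t\<in>A. w t a * \<gamma> t a - w t b * \<gamma> t b) = S a - S b" for a b
    unfolding S_def using infsum_add[OF summ[of a] summable_on_uminus[THEN iffD2, OF summ[of b]]]
    by (simp add: infsum_uminus)
  ultimately have lim0: "(\<lambda>n. \<bar>S (x (Suc n)) - S (x n)\<bar>) \<longlonglongrightarrow> 0"
    using tendsto_rabs by fastforce
  assume "\<not> ?thesis"
  then obtain r where r: "sup_error T (w, \<gamma>) < ereal r" "r < (ell 2 - ell (- 2)) / 2"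
    using ereal_dense2 by (metis less_ereal.simps(1) not_le)
  have err: "\<bar>g1 \<tau> - S \<tau>\<bar> < r" for \<tau>
  proof -
    have "ereal \<bar>g1 \<tau> - S \<tau>\<bar> \<le> sup_error T (w, \<gamma>)"
      unfolding sup_error_def S_def A_def by (auto intro: SUP_upper)
    then show ?thesis using r(1) by (metis le_less_trans less_ereal.simps(1))
  qed
  \<comment> \<open>Triangle inequality at two consecutive peaks: the jump of \<open>g1\<close> is
    the full spread, and \<open>S\<close> is within \<open>r\<close> of it at both. The aggregate
    would then keep jumping by a fixed positive amount.\<close>
  have "ell 2 - ell (- 2) - 2 * r \<le> \<bar>S (x (Suc n)) - S (x n)\<bar>" for n
    using err[of "x n"] err[of "x (Suc n)"] g1_consecutive_peaks[of n, folded x_def] unfolding x_def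
    by linarith
  then have "ell 2 - ell (- 2) - 2 * r \<le> 0"
    by (intro tendsto_lowerbound[OF lim0]) auto
  then show False using r(2) by simp
qed

section \<open>Attainment by a constant share, and the combined statement\<close>

lemma TV_const: "TV (\<lambda>_. c) \<le> 0"
  unfolding TV_def by (intro SUP_least) auto

text \<open>Android 1, present for every \<open>T\<close>, carries all the weight. Its weight lies
  in the cone with all coefficients 1, since the Bernstein polynomials sum to 1.\<close>

lemma constant_share_half_feasible:
  assumes "0 \<le> G" and "1 \<le> T"
  shows "((\<lambda>t _. if t = 1 then 1 else 0), (\<lambda>_ _. 1 / 2)) \<in> feasible q G T"
proof -
  have "(\<lambda>_. if t = 1 then 1 else 0) \<in> bernstein_cone q" for t :: nat
    unfolding bernstein_cone_def
    by (intro CollectI exI[of _ "\<lambda>_. if t = 1 then 1 else 0"]) auto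
  moreover have "1 \<in> androids T" using assms by (simp add: androids_def one_enat_def)
  then have "((\<lambda>t. if t = 1 then 1 else 0) has_sum (1::real)) (androids T)"
    by (subst has_sum_cong_neutral[where T = "{1}" and g = "\<lambda>_. 1"]) (auto intro: has_sum_finiteI)
  moreover have "TV (\<lambda>_. 1 / 2) \<le> ereal G"
    using TV_const[of "1/2"] assms by (simp add: order_trans)
  ultimately show ?thesis by (auto simp: feasible_def)
qed

lemma constant_share_half_sup_error:
  assumes "1 \<le> T"
  shows "sup_error T ((\<lambda>t _. if t = 1 then 1 else 0), (\<lambda>_ _. 1 / 2)) \<le> ereal ((ell 2 - ell (- 2)) / 2)"
proof -
  have "1 \<in> androids T" using assms by (simp add: androids_def one_enat_def)
  then have "(\<Sum>\<^sub>\<infinity>t\<in>androids T. (if t = 1 then 1 else 0) * (1 / 2)) = (\<Sum>\<^sub>\<infinity>t\<in>{1::nat}. 1 / 2 :: real)"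
    by (intro infsum_cong_neutral) auto
  then have eq: "(\<Sum>\<^sub>\<infinity>t\<in>androids T. (if t = 1 then 1 else 0) * (1 / 2)) = (1 / 2 :: real)"
    by simp
  show ?thesis
    unfolding sup_error_def case_prod_conv eq
    by (intro SUP_least) (simp only: ereal_less_eq abs_g1_diff_half_le)
qed

theorem corollaryE1:
  fixes q :: nat and G :: real and T :: enat
  assumes "0 \<le> G" and "1 \<le> T"
  shows "(\<forall>p1 p2 b :: real. 0 < p1 \<and> 0 < p2 \<and> p1 + p2 = 1 \<and> 0 < b \<longrightarrow>
            (\<exists>!x. x \<in> demand utility p1 p2 b) \<and>
            (\<forall>x \<in> demand utility p1 p2 b. p1 * fst x / b = g1 (ln (p1 / p2))))
       \<and> (INF F \<in> feasible q G T. sup_error T F) = ereal ((ell 2 - ell (- 2)) / 2)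
       \<and> (ell 2 - ell (- 2)) / 2 = tanh 1 / 2
       \<and> \<bar>tanh 1 / 2 - 0.3808 :: real\<bar> < 0.00005
       \<and> (\<exists>(w, \<gamma>) \<in> feasible q G T.
             (\<forall>t\<in>androids T. \<exists>c. \<forall>\<tau>. \<gamma> t \<tau> = c) \<and>
             sup_error T (w, \<gamma>) = ereal ((ell 2 - ell (- 2)) / 2))"
proof -
  let ?C = "ereal ((ell 2 - ell (- 2)) / 2)"
  let ?F = "((\<lambda>t _. if t = 1 then 1 else 0), (\<lambda>_ _. 1 / 2)) :: (nat \<Rightarrow> real \<Rightarrow> real) \<times> (nat \<Rightarrow> real \<Rightarrow> real)"
  have F: "?F \<in> feasible q G T" using assms by (rule constant_share_half_feasible)
  have lower: "?C \<le> sup_error T F" if "F \<in> feasible q G T" for F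
    using that half_spread_le_sup_error by (cases F) blast
  have att: "sup_error T ?F = ?C"
    by (rule antisym[OF constant_share_half_sup_error[OF assms(2)] lower[OF F]])
  have "(INF F \<in> feasible q G T. sup_error T F) = ?C"
    by (intro antisym INF_greatest lower) (use INF_lower[OF F, of "sup_error T"] att in simp_all)
  moreover have "\<forall>p1 p2 b. 0 < p1 \<and> 0 < p2 \<and> p1 + p2 = 1 \<and> 0 < b \<longrightarrow>
      (\<exists>!x. x \<in> demand utility p1 p2 b) \<and>
      (\<forall>x \<in> demand utility p1 p2 b. p1 * fst x / b = g1 (ln (p1 / p2)))"
    by (intro allI impI conjI ballI expenditure_share_utility) (auto simp: demand_utility)
  moreover have "\<exists>(w, \<gamma>) \<in> feasible q G T.
      (\<forall>t\<in>androids T. \<exists>c. \<forall>\<tau>. \<gamma> t \<tau> = c) \<and> sup_error T (w, \<gamma>) = ?C"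
  proof (rule bexI[OF _ F])
    show "case ?F of (w, \<gamma>) \<Rightarrow>
        (\<forall>t\<in>androids T. \<exists>c. \<forall>\<tau>. \<gamma> t \<tau> = c) \<and> sup_error T (w, \<gamma>) = ?C"
      unfolding case_prod_conv by (intro conjI ballI exI[of _ "1 / 2"] allI refl att)
  qed
  ultimately show ?thesis
    using ell_diff_eq_tanh tanh_1_approx by (intro conjI)
qed

end
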